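(* Let $\Delta$ be a $d$-dimensional fan in $\mathbb{R}^d$ with ray vectors $v_1,\ldots,v_N$, let $w\in\operatorname{MW}_d(\Delta)$, and let $v_0\in\mathbb{R}^d$ be a general vector. For each $\sigma\in\Delta_d$ and each generator $v_i$ of $\sigma$, let $X_i^\sigma$ be defined from the $d\times(d+1)$ matrix whose columns are $v_0$ followed by the generators of $\sigma$, as $\pm$ the determinant of this matrix with the column $v_i$ removed (sign $(-1)^k$ if $v_i$ is the $k$-th generator, the generators being listed in a fixed order). Then for every homogeneous degree $d$ polynomial $f\in\mathbb{R}[\partial_1,\ldots,\partial_N]$, \[\operatorname{Vol}_w f=\sum_{\sigma\in\Delta_d}w_\sigma\frac{f(X^\sigma)}{\prod_{v_i\in\sigma}X_i^\sigma},\] where $f(X^\sigma)$ is obtained by setting $\partial_i=X_i^\sigma$ if $v_i$ is a generator of $\sigma$ and $\partial_i=0$ otherwise, and the denominator is the product of the $d$ numbers $X_i^\sigma$ over the generators of $\sigma$.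
   Context: A fan in $\mathbb{R}^d$: a pure $d$-dimensional abstract simplicial fan with ray vectors $v_1,\ldots,v_N\in\mathbb{R}^d$ linearly independent on each cone. $\mathcal A(\Delta)=\mathbb{R}[\partial_1,\ldots,\partial_N]/I$ is the Stanley–Reisner ring ($I$ generated by square-free monomials of rays not in a common cone), and $\operatorname{CH}(\Delta)=\mathcal A(\Delta)/(\theta_1,\ldots,\theta_d)$, $\theta_k=\sum_s(v_s)_k\partial_s$. $\Delta_d$ is the set of $d$-cones and $\partial_\sigma$ the product of $\partial_s$ over rays of $\sigma$. $\operatorname{MW}_d(\Delta)$: vectors $(w_\sigma)$ such that for each $(d-1)$-cone $\tau$, with $\sigma_1,\ldots,\sigma_t$ the $d$-cones containing $\tau$ and $u_k$ the generator of $\sigma_k$ not in $\tau$, $\sum_kw_{\sigma_k}u_k$ is in the span of $\tau$. For $w\in\operatorname{MW}_d(\Delta)$, $\phi_w:\operatorname{CH}^d(\Delta)\to\mathbb{R}$ is the unique linear map with $\phi_w(\partial_\sigma)=w_\sigma$, and the mixed volume $\operatorname{Vol}_w:\mathbb{R}[\partial_1,\ldots,\partial_N]_d\to\mathbb{R}$ is the composition of the quotient map to $\operatorname{CH}^d(\Delta)$ with $\phi_w$. *)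

theory Defs
  imports "HOL-Analysis.Analysis" "HOL-Library.Poly_Mapping" "HOL-Algebra.QuotRing"
begin

section \<open>Fans and Minkowski weights\<close>

text \<open>
  Rays are indexed by a finite type \<open>'n\<close>, and \<open>v i\<close> is the ray vector of ray \<open>i\<close>.
  A cone is identified with the set of its rays; a \<open>k\<close>-dimensional cone has \<open>k\<close> rays.
  Since the fan is abstract, different cones may overlap in space.
\<close>

definition cones :: "'n set set \<Rightarrow> nat \<Rightarrow> 'n set set" where
  "cones \<Delta> k = {\<sigma> \<in> \<Delta>. card \<sigma> = k}"

definition is_fan :: "'n::finite set set \<Rightarrow> ('n \<Rightarrow> real ^ 'd) \<Rightarrow> bool" where
  "is_fan \<Delta> v \<longleftrightarrow>
     (\<forall>\<sigma>\<in>\<Delta>. \<forall>\<tau>. \<tau> \<subseteq> \<sigma> \<longrightarrow> \<tau> \<in> \<Delta>) \<and>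
     (\<forall>i. {i} \<in> \<Delta>) \<and>
     (\<forall>\<sigma>\<in>\<Delta>. \<exists>\<rho>\<in>cones \<Delta> CARD('d). \<sigma> \<subseteq> \<rho>) \<and>
     (\<forall>\<sigma>\<in>\<Delta>. inj_on v \<sigma> \<and> independent (v ` \<sigma>))"

text \<open>
  In a Minkowski weight only the values \<open>w \<sigma>\<close> on the \<open>d\<close>-dimensional cones matter.
\<close>

definition MW :: "'n::finite set set \<Rightarrow> ('n \<Rightarrow> real ^ 'd) \<Rightarrow> ('n set \<Rightarrow> real) set" where
  "MW \<Delta> v =
     {w. \<forall>\<tau>\<in>cones \<Delta> (CARD('d) - 1).
           (\<Sum>\<sigma> | \<sigma> \<in> cones \<Delta> CARD('d) \<and> \<tau> \<subseteq> \<sigma>. w \<sigma> *\<^sub>R v (the_elem (\<sigma> - \<tau>)))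
             \<in> span (v ` \<tau>)}"


section \<open>Polynomials\<close>

text \<open>
  A polynomial in the variables \<open>\<partial>\<^sub>i\<close> is a finitely supported function from exponent vectors
  to coefficients; multiplication in \<open>Poly_Mapping\<close> is convolution.
\<close>

type_synonym 'n mpoly = "('n \<Rightarrow>\<^sub>0 nat) \<Rightarrow>\<^sub>0 real"

definition const :: "real \<Rightarrow> 'n mpoly" where
  "const c = Poly_Mapping.single 0 c"

definition del :: "'n \<Rightarrow> 'n mpoly" where
  "del i = Poly_Mapping.single (Poly_Mapping.single i 1) 1"

definition del_cone :: "'n set \<Rightarrow> 'n mpoly" where
  "del_cone \<sigma> = (\<Prod>i\<in>\<sigma>. del i)"

definition homogeneous :: "nat \<Rightarrow> 'n::finite mpoly \<Rightarrow> bool" where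
  "homogeneous k f \<longleftrightarrow>
     (\<forall>m\<in>Poly_Mapping.keys f. (\<Sum>i\<in>UNIV. Poly_Mapping.lookup m i) = k)"

definition eval_mpoly :: "'n::finite mpoly \<Rightarrow> ('n \<Rightarrow> real) \<Rightarrow> real" where
  "eval_mpoly f x =
     (\<Sum>m\<in>Poly_Mapping.keys f.
        Poly_Mapping.lookup f m * (\<Prod>i\<in>UNIV. x i ^ Poly_Mapping.lookup m i))"


section \<open>The Stanley--Reisner ring and the Chow ring\<close>

definition mpoly_ring :: "'n mpoly ring" where
  "mpoly_ring = \<lparr>carrier = UNIV, mult = (*), one = 1, zero = 0, add = (+)\<rparr>"

lemma mpoly_ring_cring: "cring mpoly_ring"
proof (rule cringI)
  show "abelian_group mpoly_ring"
    by (rule abelian_groupI)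
      (auto simp: mpoly_ring_def algebra_simps intro: exI[of _ "- x" for x] add.left_inverse)
  show "Group.comm_monoid mpoly_ring"
    by (rule comm_monoidI) (auto simp: mpoly_ring_def algebra_simps)
qed (auto simp: mpoly_ring_def algebra_simps)

definition SR_ideal :: "'n set set \<Rightarrow> 'n mpoly set" where
  "SR_ideal \<Delta> = genideal mpoly_ring {del_cone S | S. \<not> (\<exists>\<sigma>\<in>\<Delta>. S \<subseteq> \<sigma>)}"

definition SR_ring :: "'n set set \<Rightarrow> 'n mpoly set ring" where
  "SR_ring \<Delta> = mpoly_ring Quot SR_ideal \<Delta>"

definition SR_class :: "'n set set \<Rightarrow> 'n mpoly \<Rightarrow> 'n mpoly set" where
  "SR_class \<Delta> f = SR_ideal \<Delta> +>\<^bsub>mpoly_ring\<^esub> f"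

definition theta :: "('n::finite \<Rightarrow> real ^ 'd) \<Rightarrow> 'd \<Rightarrow> 'n mpoly" where
  "theta v k = (\<Sum>s\<in>UNIV. const (v s $ k) * del s)"

definition CH_ideal :: "'n::finite set set \<Rightarrow> ('n \<Rightarrow> real ^ 'd) \<Rightarrow> 'n mpoly set set" where
  "CH_ideal \<Delta> v = genideal (SR_ring \<Delta>) (range (\<lambda>k. SR_class \<Delta> (theta v k)))"

definition CH :: "'n::finite set set \<Rightarrow> ('n \<Rightarrow> real ^ 'd) \<Rightarrow> 'n mpoly set set ring" where
  "CH \<Delta> v = SR_ring \<Delta> Quot CH_ideal \<Delta> v"

definition CH_class ::
    "'n::finite set set \<Rightarrow> ('n \<Rightarrow> real ^ 'd) \<Rightarrow> 'n mpoly \<Rightarrow> 'n mpoly set set" where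
  "CH_class \<Delta> v f = CH_ideal \<Delta> v +>\<^bsub>SR_ring \<Delta>\<^esub> SR_class \<Delta> f"

definition CH_graded ::
    "'n::finite set set \<Rightarrow> ('n \<Rightarrow> real ^ 'd) \<Rightarrow> nat \<Rightarrow> 'n mpoly set set set" where
  "CH_graded \<Delta> v k = CH_class \<Delta> v ` {f. homogeneous k f}"


section \<open>Mixed volume\<close>

text \<open>Scalars act on the Chow ring through the classes of constant polynomials.\<close>

definition CH_linear ::
    "'n::finite set set \<Rightarrow> ('n \<Rightarrow> real ^ 'd) \<Rightarrow> nat \<Rightarrow> ('n mpoly set set \<Rightarrow> real) \<Rightarrow> bool" where
  "CH_linear \<Delta> v k \<phi> \<longleftrightarrow>
     (\<forall>x\<in>CH_graded \<Delta> v k. \<forall>y\<in>CH_graded \<Delta> v k. \<phi> (x \<oplus>\<^bsub>CH \<Delta> v\<^esub> y) = \<phi> x + \<phi> y) \<and>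
     (\<forall>c. \<forall>x\<in>CH_graded \<Delta> v k. \<phi> (CH_class \<Delta> v (const c) \<otimes>\<^bsub>CH \<Delta> v\<^esub> x) = c * \<phi> x)"

text \<open>
  Restricting to \<open>extensional\<close> functions makes the linear map on the degree \<open>d\<close> part unique
  as a total function of HOL.
\<close>

definition phi ::
    "'n::finite set set \<Rightarrow> ('n \<Rightarrow> real ^ 'd) \<Rightarrow> ('n set \<Rightarrow> real) \<Rightarrow> 'n mpoly set set \<Rightarrow> real" where
  "phi \<Delta> v w =
     (THE \<phi>. \<phi> \<in> extensional (CH_graded \<Delta> v CARD('d)) \<and>
             CH_linear \<Delta> v CARD('d) \<phi> \<and>
             (\<forall>\<sigma>\<in>cones \<Delta> CARD('d). \<phi> (CH_class \<Delta> v (del_cone \<sigma>)) = w \<sigma>))"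

definition Vol ::
    "'n::finite set set \<Rightarrow> ('n \<Rightarrow> real ^ 'd) \<Rightarrow> ('n set \<Rightarrow> real) \<Rightarrow> 'n mpoly \<Rightarrow> real" where
  "Vol \<Delta> v w f = phi \<Delta> v w (CH_class \<Delta> v f)"


section \<open>General vectors and the numbers \<open>X\<^sub>i\<^sup>\<sigma>\<close>\<close>

text \<open>
  ``General'' means: off the spans of the finitely many \<open>(d-1)\<close>-dimensional cones.  These are
  exactly the vectors for which no \<open>X\<^sub>i\<^sup>\<sigma>\<close> vanishes.
\<close>

definition general_vector ::
    "'n::finite set set \<Rightarrow> ('n \<Rightarrow> real ^ 'd) \<Rightarrow> real ^ 'd \<Rightarrow> bool" where
  "general_vector \<Delta> v v0 \<longleftrightarrow> (\<forall>\<tau>\<in>cones \<Delta> (CARD('d) - 1). v0 \<notin> span (v ` \<tau>))"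

lemma general_vector_open_dense:
  fixes v :: "'n::finite \<Rightarrow> real ^ 'd"
  shows "open {v0. general_vector \<Delta> v v0}" "closure {v0. general_vector \<Delta> v v0} = UNIV"
proof -
  let ?B = "\<Union>\<tau>\<in>cones \<Delta> (CARD('d) - 1). span (v ` \<tau>)"
  have eq: "{v0. general_vector \<Delta> v v0} = - ?B"
    by (auto simp: general_vector_def)
  have "negligible (span (v ` \<tau>))" if "\<tau> \<in> cones \<Delta> (CARD('d) - 1)" for \<tau>
  proof (rule negligible_lowdim)
    have "dim (span (v ` \<tau>)) \<le> card (v ` \<tau>)"
      by (simp add: dim_le_card')
    also have "\<dots> \<le> CARD('d) - 1"
      using that by (metis (mono_tags, lifting) card_image_le cones_def finite mem_Collect_eq)
    also have "\<dots> < DIM(real ^ 'd)"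
      by simp
    finally show "dim (span (v ` \<tau>)) < DIM(real ^ 'd)" .
  qed
  then have "negligible ?B"
    by (intro negligible_Union) auto
  then have "interior ?B = {}"
    using negligible_subset interior_subset open_not_negligible open_interior by blast
  then show "closure {v0. general_vector \<Delta> v v0} = UNIV"
    by (simp only: eq closure_complement) simp
  show "open {v0. general_vector \<Delta> v v0}"
    unfolding eq by (intro open_Compl closed_UN) auto
qed

text \<open>
  Determinant of the square matrix whose columns, from left to right, are the vectors of a list
  of length \<open>d\<close>.  The coordinate indices are linearly ordered, and \<open>card {i. i < j}\<close> is the
  zero-based position of the index \<open>j\<close>.
\<close>

definition det_cols :: "(real ^ 'd::{finite,linorder}) list \<Rightarrow> real" where
  "det_cols cs = det (\<chi> i j. (cs ! card {l. l < j}) $ i)"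

definition remove_col :: "nat \<Rightarrow> 'a list \<Rightarrow> 'a list" where
  "remove_col k cs = take k cs @ drop (Suc k) cs"

text \<open>
  \<open>gs\<close> lists the generators of a cone in a fixed order.  Column 0 of the list \<open>v0 # map v gs\<close>
  is \<open>v0\<close>, so its column \<open>k\<close> is the \<open>k\<close>-th generator, counting generators from 1.
\<close>

definition X_entry ::
    "('n \<Rightarrow> real ^ 'd::{finite,linorder}) \<Rightarrow> real ^ 'd::{finite,linorder} \<Rightarrow> 'n list \<Rightarrow> nat \<Rightarrow> real" where
  "X_entry v v0 gs k = (-1) ^ k * det_cols (remove_col k (v0 # map v gs))"

definition X ::
    "('n \<Rightarrow> real ^ 'd::{finite,linorder}) \<Rightarrow> real ^ 'd::{finite,linorder} \<Rightarrow> 'n list \<Rightarrow> 'n \<Rightarrow> real" where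
  "X v v0 gs i =
     (if i \<in> set gs
      then X_entry v v0 gs (THE k. 1 \<le> k \<and> k \<le> length gs \<and> gs ! (k - 1) = i)
      else 0)"

end

theory Submission
  imports Defs
begin

text \<open>
  For a maximal cone \<open>\<sigma>\<close> let \<open>c\<^sup>\<sigma>\<close> be the coordinates of \<open>v0\<close> in the basis \<open>v ` \<sigma>\<close>.
  By Cramer's rule \<open>X\<^sup>\<sigma>\<close> is a nonzero multiple of \<open>c\<^sup>\<sigma>\<close>, and the summands of the formula
  have degree 0 in \<open>X\<^sup>\<sigma>\<close>, so \<open>X\<^sup>\<sigma>\<close> may be replaced by \<open>c\<^sup>\<sigma>\<close>.  Let \<open>F f\<close> be the sum
  of \<open>w \<sigma> * f(c\<^sup>\<sigma>) / \<Prod>c\<^sup>\<sigma>\<close> over the maximal cones.  Since \<open>\<theta>\<^sub>k(c\<^sup>\<sigma>)\<close> is the \<open>k\<close>-th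
  coordinate of \<open>v0\<close> for every \<open>\<sigma>\<close>, we have \<open>F (\<theta>\<^sub>k * f) = v0\<^sub>k * F f\<close>, and thus \<open>F\<close> descends
  to the Chow ring in degree \<open>d\<close> once it vanishes in degree \<open>d - 1\<close>.  On the square-free monomial of
  a \<open>(d-1)\<close>-cone this is the balancing condition on \<open>w\<close>; all other monomials of degree less than
  \<open>d\<close> reduce to these through the linear relations.  Finally \<open>F (\<partial>\<^sub>\<sigma>) = w \<sigma>\<close>, and the
  \<open>\<partial>\<^sub>\<sigma>\<close> span the degree \<open>d\<close> part of the Chow ring.
\<close>

section \<open>Monomials and linear extension\<close>

abbreviation var :: "'n \<Rightarrow> 'n \<Rightarrow>\<^sub>0 nat" where
  "var i \<equiv> Poly_Mapping.single i (Suc 0)"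

abbreviation monomial :: "('n \<Rightarrow>\<^sub>0 nat) \<Rightarrow> 'n mpoly" where
  "monomial a \<equiv> Poly_Mapping.single a 1"

definition deg :: "('n::finite \<Rightarrow>\<^sub>0 nat) \<Rightarrow> nat" where
  "deg a = (\<Sum>i\<in>UNIV. Poly_Mapping.lookup a i)"

definition eval_mon :: "('n::finite \<Rightarrow> real) \<Rightarrow> ('n \<Rightarrow>\<^sub>0 nat) \<Rightarrow> real" where
  "eval_mon x a = (\<Prod>i\<in>UNIV. x i ^ Poly_Mapping.lookup a i)"

text \<open>Linear functionals on polynomials are encoded by their values on monomials, so
  evaluation and the volume share the same linearity rules.\<close>

definition lin_ext :: "(('n \<Rightarrow>\<^sub>0 nat) \<Rightarrow> real) \<Rightarrow> 'n mpoly \<Rightarrow> real" where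
  "lin_ext T f = (\<Sum>a\<in>Poly_Mapping.keys f. Poly_Mapping.lookup f a * T a)"

lemma deg_add: "deg (a + b) = deg a + deg b"
  by (simp add: deg_def lookup_add sum.distrib)

lemma deg_var [simp]: "deg (var i) = 1"
  by (simp add: deg_def lookup_single when_def)

lemma keys_add_var:
  "Poly_Mapping.keys (a + var i) = insert i (Poly_Mapping.keys a)"
  for a :: "'n \<Rightarrow>\<^sub>0 nat"
  by (auto simp: in_keys_iff lookup_add lookup_single when_def split: if_splits)

lemma deg_eq_sum_keys: "deg a = (\<Sum>i\<in>Poly_Mapping.keys a. Poly_Mapping.lookup a i)"
  unfolding deg_def by (rule sum.mono_neutral_right) (auto simp: in_keys_iff)

lemma card_keys_le_deg: "card (Poly_Mapping.keys a) \<le> deg a"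
proof -
  have "(\<Sum>i\<in>Poly_Mapping.keys a. 1) \<le> (\<Sum>i\<in>Poly_Mapping.keys a. Poly_Mapping.lookup a i)"
    by (rule sum_mono) (simp add: in_keys_iff Suc_leI)
  then show ?thesis by (simp add: deg_eq_sum_keys)
qed

lemma var_factor:
  assumes "i \<in> Poly_Mapping.keys a"
  obtains b where "a = b + var i"
proof
  show "a = (a - var i) + var i"
    using assms by (intro poly_mapping_eqI)
      (auto simp: lookup_add lookup_minus lookup_single when_def in_keys_iff)
qed

lemma eval_mon_add: "eval_mon x (a + b) = eval_mon x a * eval_mon x b"
  by (simp add: eval_mon_def lookup_add power_add prod.distrib)

lemma eval_mon_var [simp]: "eval_mon x (var i) = x i"
proof -
  have "eval_mon x (var i) = (\<Prod>j\<in>UNIV. if j = i then x j else 1)"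
    unfolding eval_mon_def by (rule prod.cong) (auto simp: lookup_single when_def)
  then show ?thesis by simp
qed

lemma eval_mon_eq_0:
  assumes "i \<in> Poly_Mapping.keys a" "x i = 0"
  shows "eval_mon x a = 0"
  unfolding eval_mon_def using assms by (intro prod_zero) (auto simp: in_keys_iff)

lemma eval_mon_scale: "eval_mon (\<lambda>i. r * x i) a = r ^ deg a * eval_mon x a"
  by (simp add: eval_mon_def deg_def power_mult_distrib prod.distrib power_sum)

text \<open>The exponents on the support are at least 1, so a larger one would push the degree above
  the size of the support.\<close>

lemma square_free_monomial:
  fixes a :: "'n::finite \<Rightarrow>\<^sub>0 nat"
  assumes "deg a = card (Poly_Mapping.keys a)"
  shows "Poly_Mapping.lookup a i = (if i \<in> Poly_Mapping.keys a then 1 else 0)"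
proof -
  have "Poly_Mapping.lookup a i = 1" if i: "i \<in> Poly_Mapping.keys a"
  proof (rule ccontr)
    assume "Poly_Mapping.lookup a i \<noteq> 1"
    with i have "1 < Poly_Mapping.lookup a i"
      by (simp add: in_keys_iff)
    then have "(\<Sum>i\<in>Poly_Mapping.keys a. 1) < (\<Sum>i\<in>Poly_Mapping.keys a. Poly_Mapping.lookup a i)"
      using i by (intro sum_strict_mono_ex1) (auto simp: in_keys_iff Suc_leI)
    then show False using assms by (simp add: deg_eq_sum_keys)
  qed
  then show ?thesis by (simp add: in_keys_iff)
qed

lemma eval_mon_square_free:
  assumes "deg a = card (Poly_Mapping.keys a)"
  shows "eval_mon x a = (\<Prod>i\<in>Poly_Mapping.keys a. x i)"
  unfolding eval_mon_def
  by (simp add: square_free_monomial[OF assms] prod.If_cases if_distrib cong: if_cong)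

text \<open>Pigeonhole on the exponents. Since \<open>i\<close> stays in the support of
  \<open>b\<close>, dividing by this variable leaves the support unchanged.\<close>

lemma repeated_variable:
  assumes "card (Poly_Mapping.keys a) < deg a"
  obtains i b where "a = b + var i" "i \<in> Poly_Mapping.keys b"
proof -
  have "\<exists>i\<in>Poly_Mapping.keys a. 1 < Poly_Mapping.lookup a i"
  proof (rule ccontr)
    assume "\<not> ?thesis"
    then have "(\<Sum>i\<in>Poly_Mapping.keys a. Poly_Mapping.lookup a i) \<le> (\<Sum>i\<in>Poly_Mapping.keys a. 1)"
      by (intro sum_mono) (auto simp: not_less)
    then show False using assms by (simp add: deg_eq_sum_keys)
  qed
  then obtain i where i: "i \<in> Poly_Mapping.keys a" "1 < Poly_Mapping.lookup a i" by blast
  obtain b where b: "a = b + var i" using var_factor[OF i(1)] .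
  have "i \<in> Poly_Mapping.keys b" using i(2) by (simp add: b lookup_add in_keys_iff)
  with b show thesis by (rule that)
qed

section \<open>Monomials as polynomials, and homogeneity\<close>

lemma monomial_mult: "monomial a * monomial b = monomial (a + b)"
  by (simp add: mult_single)

lemma const_mult_single: "const c * Poly_Mapping.single a r = Poly_Mapping.single a (c * r)"
  by (simp add: const_def mult_single)

lemma const_add: "const (a + b) = const a + const b"
  by (simp add: const_def single_add)

lemma const_sum: "const (\<Sum>i\<in>A. r i) = (\<Sum>i\<in>A. const (r i))"
  by (induction A rule: infinite_finite_induct) (simp_all add: const_add, simp_all add: const_def)

lemma const_mult: "const a * const b = const (a * b)"
  by (simp add: const_def mult_single)

lemma monomial_square_free:
  assumes "finite S"
  shows "monomial (\<Sum>i\<in>S. var i) = del_cone S"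
  unfolding del_cone_def del_def using assms
  by (induction S rule: finite_induct) (auto simp: monomial_mult[symmetric])

lemma monomial_eq_del_cone:
  assumes "deg a = card (Poly_Mapping.keys a)"
  shows "monomial a = del_cone (Poly_Mapping.keys a)"
proof -
  have "a = (\<Sum>i\<in>Poly_Mapping.keys a. var i)"
    by (rule poly_mapping_eqI)
      (simp add: square_free_monomial[OF assms] lookup_sum lookup_single when_def)
  then show ?thesis
    using monomial_square_free[OF finite_keys, of a] by simp
qed

lemma monomial_dvd_del_cone:
  "\<exists>b. monomial a = monomial b * del_cone (Poly_Mapping.keys a)"
proof -
  let ?s = "\<Sum>i\<in>Poly_Mapping.keys a. var i"
  \<comment> \<open>Subtraction of exponents stops at 0, but the exponents on the support are at
    least 1, so nothing is cut off.\<close>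
  have "a = (a - ?s) + ?s"
    by (rule poly_mapping_eqI)
      (auto simp: lookup_add lookup_minus lookup_sum lookup_single when_def in_keys_iff)
  then have "monomial a = monomial (a - ?s) * monomial ?s"
    by (simp add: monomial_mult)
  also have "monomial ?s = del_cone (Poly_Mapping.keys a)"
    by (rule monomial_square_free) simp
  finally show ?thesis ..
qed

lemma homogeneous_iff: "homogeneous k f \<longleftrightarrow> (\<forall>a\<in>Poly_Mapping.keys f. deg a = k)"
  by (simp add: homogeneous_def deg_def)

lemma homogeneous_add:
  assumes "homogeneous k f" "homogeneous k g"
  shows "homogeneous k (f + g)"
  using assms keys_add[of f g] unfolding homogeneous_iff by blast

lemma homogeneous_const_mult:
  assumes "homogeneous k f"
  shows "homogeneous k (const c * f)"
  using assms keys_mult[of "const c" f] unfolding homogeneous_iff const_def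
  by (fastforce split: if_splits)

lemma homogeneous_monomial: "homogeneous (deg a) (monomial a)"
  by (simp add: homogeneous_iff)

lemma homogeneous_sum:
  assumes "\<And>s. s \<in> A \<Longrightarrow> homogeneous k (f s)"
  shows "homogeneous k (sum f A)"
proof -
  have "homogeneous k 0" by (simp add: homogeneous_iff)
  then show ?thesis
    using assms by (induction A rule: infinite_finite_induct) (auto intro: homogeneous_add)
qed

lemma mpoly_eq_sum_monomials:
  "f = (\<Sum>a\<in>Poly_Mapping.keys f. const (Poly_Mapping.lookup f a) * monomial a)"
  by (rule poly_mapping_eqI)
    (simp add: lookup_sum const_mult_single lookup_single when_def in_keys_iff)

section \<open>Linear functionals on polynomials\<close>

lemma lin_ext_superset:
  assumes "finite A" "Poly_Mapping.keys f \<subseteq> A"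
  shows "lin_ext T f = (\<Sum>a\<in>A. Poly_Mapping.lookup f a * T a)"
  unfolding lin_ext_def using assms by (intro sum.mono_neutral_left) (auto simp: in_keys_iff)

lemma lin_ext_add: "lin_ext T (f + g) = lin_ext T f + lin_ext T g"
proof -
  let ?A = "Poly_Mapping.keys f \<union> Poly_Mapping.keys g"
  have "finite ?A" by simp
  then show ?thesis
    using keys_add[of f g]
    by (simp add: lin_ext_superset[of ?A] lookup_add distrib_right sum.distrib)
qed

lemma lin_ext_zero [simp]: "lin_ext T 0 = 0"
  by (simp add: lin_ext_def)

lemma lin_ext_single [simp]: "lin_ext T (Poly_Mapping.single a r) = r * T a"
  by (simp add: lin_ext_def)

lemma lin_ext_sum: "lin_ext T (sum f A) = (\<Sum>s\<in>A. lin_ext T (f s))"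
  by (induction A rule: infinite_finite_induct) (auto simp: lin_ext_add)

lemma lin_ext_uminus: "lin_ext T (- f) = - lin_ext T f"
  using lin_ext_add[of T f "- f"] by simp

lemma mult_eq_sum_monomials:
  "f * g = (\<Sum>a\<in>Poly_Mapping.keys f. const (Poly_Mapping.lookup f a) * (monomial a * g))"
  by (subst mpoly_eq_sum_monomials[of f]) (simp add: sum_distrib_right mult.assoc)

lemma lin_ext_const_mult: "lin_ext T (const c * f) = c * lin_ext T f"
proof -
  have "const c * f =
      (\<Sum>a\<in>Poly_Mapping.keys f. Poly_Mapping.single a (c * Poly_Mapping.lookup f a))"
    by (subst mpoly_eq_sum_monomials[of f]) (simp add: sum_distrib_left const_mult_single)
  then show ?thesis
    by (simp add: lin_ext_sum) (simp add: lin_ext_def sum_distrib_left mult.assoc)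
qed

text \<open>Expanding \<open>f\<close> into monomials reduces vanishing on the principal ideal of
  \<open>g\<close> to monomial multiples of \<open>g\<close>.\<close>

lemma lin_ext_mult_eq_0:
  assumes "\<And>a. lin_ext T (monomial a * g) = 0"
  shows "lin_ext T (f * g) = 0"
  by (subst mult_eq_sum_monomials) (simp add: lin_ext_sum lin_ext_const_mult assms)

lemma monomial_mult_linear_form:
  "monomial a * (\<Sum>s\<in>A. const (r s) * del s) = (\<Sum>s\<in>A. const (r s) * monomial (a + var s))"
  by (simp add: sum_distrib_left del_def const_mult_single mult_single)

lemma eval_mpoly_eq_lin_ext: "eval_mpoly f x = lin_ext (eval_mon x) f"
  by (simp add: eval_mpoly_def lin_ext_def eval_mon_def)

text \<open>In degree d this power of \<open>r\<close> cancels against the one from a product over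
  the d rays of a cone, so evaluation points may be rescaled.\<close>

lemma eval_mpoly_scale:
  assumes "homogeneous k f"
  shows "eval_mpoly f (\<lambda>i. r * x i) = r ^ k * eval_mpoly f x"
proof -
  have "eval_mpoly f (\<lambda>i. r * x i) =
      (\<Sum>a\<in>Poly_Mapping.keys f. r ^ k * (Poly_Mapping.lookup f a * eval_mon x a))"
    unfolding eval_mpoly_eq_lin_ext lin_ext_def
    using assms by (intro sum.cong) (auto simp: homogeneous_iff eval_mon_scale)
  then show ?thesis
    by (simp add: eval_mpoly_eq_lin_ext lin_ext_def sum_distrib_left)
qed

section \<open>Classes in the Chow ring\<close>

lemma mpoly_ring_simps [simp]:
  "carrier mpoly_ring = UNIV" "x \<otimes>\<^bsub>mpoly_ring\<^esub> y = x * y" "\<one>\<^bsub>mpoly_ring\<^esub> = 1"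
  "\<zero>\<^bsub>mpoly_ring\<^esub> = 0" "x \<oplus>\<^bsub>mpoly_ring\<^esub> y = x + y"
  by (simp_all add: mpoly_ring_def)

lemma mpoly_ring_ring: "ring mpoly_ring"
  by (rule cring.axioms[OF mpoly_ring_cring])

lemma mpoly_ring_a_inv [simp]: "\<ominus>\<^bsub>mpoly_ring\<^esub> x = - x"
proof -
  interpret cring mpoly_ring by (rule mpoly_ring_cring)
  show ?thesis by (rule minus_equality) auto
qed

lemma mpoly_ring_idealI:
  assumes "0 \<in> I" "\<And>f g. f \<in> I \<Longrightarrow> g \<in> I \<Longrightarrow> f + g \<in> I" "\<And>f h. f \<in> I \<Longrightarrow> h * f \<in> I"
  shows "ideal I mpoly_ring"
proof (rule idealI)
  show "ring mpoly_ring" by (rule mpoly_ring_ring)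
  have "- f \<in> I" if "f \<in> I" for f
    using assms(3)[OF that, of "- 1"] by simp
  then have "inv\<^bsub>add_monoid mpoly_ring\<^esub> f \<in> I" if "f \<in> I" for f
    using that by (simp only: a_inv_def[symmetric] mpoly_ring_a_inv)
  then show "subgroup I (add_monoid mpoly_ring)"
    using assms(1,2) by (intro subgroup.intro) (simp_all del: a_inv_def)
  fix f h assume "f \<in> I"
  then show "h \<otimes>\<^bsub>mpoly_ring\<^esub> f \<in> I" by (simp add: assms(3))
  then show "f \<otimes>\<^bsub>mpoly_ring\<^esub> h \<in> I" by (simp add: mult.commute)
qed

lemma SR_ideal_ideal: "ideal (SR_ideal \<Delta>) mpoly_ring"
  unfolding SR_ideal_def by (rule ring.genideal_ideal[OF mpoly_ring_ring]) simp

lemma SR_ring_cring: "cring (SR_ring \<Delta>)"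
  unfolding SR_ring_def by (rule ideal.quotient_is_cring[OF SR_ideal_ideal mpoly_ring_cring])

lemma SR_class_hom: "SR_class \<Delta> \<in> ring_hom mpoly_ring (SR_ring \<Delta>)"
proof -
  have "SR_class \<Delta> = (+>\<^bsub>mpoly_ring\<^esub>) (SR_ideal \<Delta>)"
    by (rule ext) (simp add: SR_class_def)
  then show ?thesis
    unfolding SR_ring_def using ideal.rcos_ring_hom[OF SR_ideal_ideal] by simp
qed

lemma carrier_SR_ring: "carrier (SR_ring \<Delta>) = range (SR_class \<Delta>)"
  by (auto simp: SR_ring_def SR_class_def FactRing_def A_RCOSETS_def')

lemma SR_class_closed: "SR_class \<Delta> f \<in> carrier (SR_ring \<Delta>)"
  by (simp add: carrier_SR_ring)

lemma CH_ideal_ideal: "ideal (CH_ideal \<Delta> v) (SR_ring \<Delta>)"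
  unfolding CH_ideal_def
  by (rule ring.genideal_ideal[OF cring.axioms(1)[OF SR_ring_cring]]) (auto simp: SR_class_closed)

lemma CH_class_hom: "CH_class \<Delta> v \<in> ring_hom mpoly_ring (CH \<Delta> v)"
proof -
  have "(+>\<^bsub>SR_ring \<Delta>\<^esub>) (CH_ideal \<Delta> v) \<circ> SR_class \<Delta> \<in> ring_hom mpoly_ring (CH \<Delta> v)"
    unfolding CH_def by (rule ring_hom_trans[OF SR_class_hom ideal.rcos_ring_hom[OF CH_ideal_ideal]])
  moreover have "CH_class \<Delta> v = (+>\<^bsub>SR_ring \<Delta>\<^esub>) (CH_ideal \<Delta> v) \<circ> SR_class \<Delta>"
    by (rule ext) (simp add: CH_class_def)
  ultimately show ?thesis by simp
qed

lemma CH_class_add: "CH_class \<Delta> v f \<oplus>\<^bsub>CH \<Delta> v\<^esub> CH_class \<Delta> v g = CH_class \<Delta> v (f + g)"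
  using ring_hom_add[OF CH_class_hom[of \<Delta> v], of f g] by simp

lemma CH_class_mult: "CH_class \<Delta> v f \<otimes>\<^bsub>CH \<Delta> v\<^esub> CH_class \<Delta> v g = CH_class \<Delta> v (f * g)"
  using ring_hom_mult[OF CH_class_hom[of \<Delta> v], of f g] by simp

lemma CH_class_non_face:
  assumes "\<not> (\<exists>\<sigma>\<in>\<Delta>. S \<subseteq> \<sigma>)"
  shows "CH_class \<Delta> v (h * del_cone S) = CH_class \<Delta> v 0"
proof -
  have "del_cone S \<in> SR_ideal \<Delta>"
    unfolding SR_ideal_def
    by (rule subsetD[OF ring.genideal_self[OF mpoly_ring_ring]]) (use assms in auto)
  then have "h \<otimes>\<^bsub>mpoly_ring\<^esub> del_cone S \<in> SR_ideal \<Delta>"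
    by (rule ideal.I_l_closed[OF SR_ideal_ideal]) simp
  then have "SR_class \<Delta> (h * del_cone S) = SR_class \<Delta> 0"
    unfolding SR_class_def
    using ring.quotient_eq_iff_same_a_r_cos[OF mpoly_ring_ring SR_ideal_ideal[of \<Delta>], of "h * del_cone S" 0]
    by (simp add: a_minus_def)
  then show ?thesis by (simp add: CH_class_def)
qed

lemma CH_class_theta: "CH_class \<Delta> v (h * theta v k) = CH_class \<Delta> v 0"
proof -
  interpret S: cring "SR_ring \<Delta>" by (rule SR_ring_cring)
  interpret I: ideal "CH_ideal \<Delta> v" "SR_ring \<Delta>" by (rule CH_ideal_ideal)
  interpret SH: ring_hom_ring mpoly_ring "SR_ring \<Delta>" "SR_class \<Delta>"
    by (rule ring_hom_ringI2[OF mpoly_ring_ring S.ring_axioms SR_class_hom])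
  have "SR_class \<Delta> (theta v k) \<in> CH_ideal \<Delta> v"
    unfolding CH_ideal_def
    by (rule subsetD[OF S.genideal_self]) (auto simp: SR_class_closed)
  then have *: "SR_class \<Delta> (h * theta v k) \<in> CH_ideal \<Delta> v"
    using I.I_l_closed[OF _ SR_class_closed[of \<Delta> h]] SH.hom_mult[of h "theta v k"] by simp
  moreover have "SR_class \<Delta> 0 = \<zero>\<^bsub>SR_ring \<Delta>\<^esub>"
    using SH.hom_zero by simp
  ultimately have "SR_class \<Delta> 0 \<in> CH_ideal \<Delta> v"
    using additive_subgroup.zero_closed[OF I.is_additive_subgroup] by simp
  then have "CH_class \<Delta> v 0 = CH_ideal \<Delta> v"
    unfolding CH_class_def by (rule S.a_rcos_zero[OF CH_ideal_ideal])
  moreover have "CH_class \<Delta> v (h * theta v k) = CH_ideal \<Delta> v"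
    unfolding CH_class_def by (rule S.a_rcos_zero[OF CH_ideal_ideal *])
  ultimately show ?thesis by simp
qed

text \<open>The two quotients are undone one at a time: the image of \<open>I\<close> in the
  Stanley-Reisner ring is an ideal containing \<open>CH_ideal\<close>, and \<open>I\<close> itself
  contains \<open>SR_ideal\<close>. This bounds the kernel of the map to the Chow ring without
  describing its elements.\<close>

lemma CH_class_eq_imp:
  assumes zero: "0 \<in> I" and add: "\<And>f g. f \<in> I \<Longrightarrow> g \<in> I \<Longrightarrow> f + g \<in> I"
    and mult: "\<And>f h. f \<in> I \<Longrightarrow> h * f \<in> I"
    and nonface: "\<And>S. \<not> (\<exists>\<sigma>\<in>\<Delta>. S \<subseteq> \<sigma>) \<Longrightarrow> del_cone S \<in> I"
    and theta: "\<And>k. theta v k \<in> I"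
    and eq: "CH_class \<Delta> v f = CH_class \<Delta> v g"
  shows "f - g \<in> I"
proof -
  interpret S: cring "SR_ring \<Delta>" by (rule SR_ring_cring)
  have I: "ideal I mpoly_ring" using zero add mult by (rule mpoly_ring_idealI)
  interpret SH: ring_hom_ring mpoly_ring "SR_ring \<Delta>" "SR_class \<Delta>"
    by (rule ring_hom_ringI2[OF mpoly_ring_ring S.ring_axioms SR_class_hom])
  have SR: "SR_ideal \<Delta> \<subseteq> I"
    unfolding SR_ideal_def
    by (rule ring.genideal_minimal[OF mpoly_ring_ring I]) (auto intro: nonface)
  have "ideal (SR_class \<Delta> ` I) (SR_ring \<Delta>)"
  proof (rule idealI)
    show "ring (SR_ring \<Delta>)" by (rule S.ring_axioms)
    show "subgroup (SR_class \<Delta> ` I) (add_monoid (SR_ring \<Delta>))"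
    proof (rule subgroup.intro)
      show "SR_class \<Delta> ` I \<subseteq> carrier (add_monoid (SR_ring \<Delta>))"
        by (auto simp: SR_class_closed)
      show "\<one>\<^bsub>add_monoid (SR_ring \<Delta>)\<^esub> \<in> SR_class \<Delta> ` I"
        using imageI[OF zero, of "SR_class \<Delta>"] SH.hom_zero by simp
      fix x y assume "x \<in> SR_class \<Delta> ` I" "y \<in> SR_class \<Delta> ` I"
      then obtain f g where fg: "x = SR_class \<Delta> f" "y = SR_class \<Delta> g" "f \<in> I" "g \<in> I" by blast
      have "x \<oplus>\<^bsub>SR_ring \<Delta>\<^esub> y = SR_class \<Delta> (f + g)"
        using SH.hom_add[of f g] fg by simp
      with add[OF fg(3,4)] have "x \<oplus>\<^bsub>SR_ring \<Delta>\<^esub> y \<in> SR_class \<Delta> ` I"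
        by (metis imageI)
      then show "x \<otimes>\<^bsub>add_monoid (SR_ring \<Delta>)\<^esub> y \<in> SR_class \<Delta> ` I"
        by simp
    next
      fix x assume "x \<in> SR_class \<Delta> ` I"
      then obtain f where fg: "x = SR_class \<Delta> f" "f \<in> I" by blast
      have "\<ominus>\<^bsub>SR_ring \<Delta>\<^esub> x = SR_class \<Delta> (- 1 * f)"
        using SH.hom_a_inv[of f] fg by simp
      with mult[OF fg(2)] have "\<ominus>\<^bsub>SR_ring \<Delta>\<^esub> x \<in> SR_class \<Delta> ` I"
        by (metis imageI)
      then show "inv\<^bsub>add_monoid (SR_ring \<Delta>)\<^esub> x \<in> SR_class \<Delta> ` I"
        by (simp only: a_inv_def)
    qed
    fix a x assume a: "a \<in> SR_class \<Delta> ` I" and x: "x \<in> carrier (SR_ring \<Delta>)"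
    from a obtain f where f: "a = SR_class \<Delta> f" "f \<in> I" by blast
    from x obtain h where h: "x = SR_class \<Delta> h"
      unfolding carrier_SR_ring by blast
    note fh = f h
    have "x \<otimes>\<^bsub>SR_ring \<Delta>\<^esub> a = SR_class \<Delta> (h * f)"
      using SH.hom_mult[of h f] fh by simp
    with mult[OF fh(2)] show *: "x \<otimes>\<^bsub>SR_ring \<Delta>\<^esub> a \<in> SR_class \<Delta> ` I"
      by (metis imageI)
    have "a \<otimes>\<^bsub>SR_ring \<Delta>\<^esub> x = x \<otimes>\<^bsub>SR_ring \<Delta>\<^esub> a"
      unfolding fh by (rule S.m_comm) (rule SR_class_closed)+
    with * show "a \<otimes>\<^bsub>SR_ring \<Delta>\<^esub> x \<in> SR_class \<Delta> ` I"
      by simp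
  qed
  then have CH: "CH_ideal \<Delta> v \<subseteq> SR_class \<Delta> ` I"
    unfolding CH_ideal_def by (rule S.genideal_minimal) (auto intro: theta)
  have "SR_class \<Delta> f \<ominus>\<^bsub>SR_ring \<Delta>\<^esub> SR_class \<Delta> g \<in> CH_ideal \<Delta> v"
    using S.quotient_eq_iff_same_a_r_cos[OF CH_ideal_ideal SR_class_closed SR_class_closed] eq
    unfolding CH_class_def by blast
  moreover have "SR_class \<Delta> f \<ominus>\<^bsub>SR_ring \<Delta>\<^esub> SR_class \<Delta> g = SR_class \<Delta> (f - g)"
    using SH.hom_add[of f "- g"] SH.hom_a_inv[of g] by (simp add: a_minus_def)
  ultimately have "SR_class \<Delta> (f - g) \<in> SR_class \<Delta> ` I"
    using CH by auto
  then obtain h where h: "h \<in> I" "SR_class \<Delta> (f - g) = SR_class \<Delta> h"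
    by blast
  \<comment> \<open>Equal classes of \<open>f - g\<close> and \<open>h\<close> differ by an element
    of \<open>SR_ideal\<close>, hence of \<open>I\<close>.\<close>
  then have "f - g - h \<in> SR_ideal \<Delta>"
    using ring.quotient_eq_iff_same_a_r_cos[OF mpoly_ring_ring SR_ideal_ideal, of "f - g" h \<Delta>]
    unfolding SR_class_def by (simp add: a_minus_def)
  then have "f - g - h \<in> I" using SR by blast
  from add[OF this h(1)] show ?thesis by simp
qed

section \<open>Localization at the maximal cones\<close>

text \<open>Independence gives a linear functional with these values on \<open>B\<close>, and its
  adjoint at 1 represents it by the inner product.\<close>

lemma exists_dual_vector:
  fixes B :: "(real ^ 'd) set"
  assumes "independent B"
  shows "\<exists>y. \<forall>b\<in>B. y \<bullet> b = g b"
proof -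
  obtain f :: "real ^ 'd \<Rightarrow> real" where f: "linear f" "\<forall>b\<in>B. f b = g b"
    using linear_independent_extend[OF assms] by blast
  have "adjoint f 1 \<bullet> b = f b" for b
    using adjoint_works[OF f(1), of b 1] by (simp add: inner_commute)
  with f(2) show ?thesis by (intro exI[of _ "adjoint f 1"]) simp
qed

locale fan =
  fixes \<Delta> :: "'n::finite set set" and v :: "'n \<Rightarrow> real ^ 'd"
  assumes fan: "is_fan \<Delta> v"
begin

lemma face_closed: "\<sigma> \<in> \<Delta> \<Longrightarrow> \<tau> \<subseteq> \<sigma> \<Longrightarrow> \<tau> \<in> \<Delta>"
  using fan unfolding is_fan_def by blast

lemma non_face: "\<tau> \<notin> \<Delta> \<longleftrightarrow> \<not> (\<exists>\<sigma>\<in>\<Delta>. \<tau> \<subseteq> \<sigma>)"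
  using face_closed by blast

lemma cone_inj: "\<sigma> \<in> \<Delta> \<Longrightarrow> inj_on v \<sigma>"
  using fan unfolding is_fan_def by blast

lemma cone_independent: "\<sigma> \<in> \<Delta> \<Longrightarrow> independent (v ` \<sigma>)"
  using fan unfolding is_fan_def by blast

lemma face_of_maximal: "\<tau> \<in> \<Delta> \<Longrightarrow> \<exists>\<sigma>\<in>cones \<Delta> CARD('d). \<tau> \<subseteq> \<sigma>"
  using fan unfolding is_fan_def by blast

text \<open>Injectivity of \<open>v\<close> on the cone allows values to be prescribed per ray. Thus
  the linear relation with coefficients \<open>y \<bullet> v s\<close> can be given any coefficients
  on one cone.\<close>

lemma dual_vector_on_cone:
  assumes "\<tau> \<in> \<Delta>"
  shows "\<exists>y. \<forall>i\<in>\<tau>. y \<bullet> v i = g i"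
proof -
  obtain y where y: "\<forall>b\<in>v ` \<tau>. y \<bullet> b = g (the_inv_into \<tau> v b)"
    using exists_dual_vector[OF cone_independent[OF assms], of "\<lambda>b. g (the_inv_into \<tau> v b)"] ..
  show ?thesis
    by (rule exI[of _ y]) (use y in \<open>simp add: the_inv_into_f_f[OF cone_inj[OF assms]]\<close>)
qed

text \<open>Adding \<open>x\<close> to the ray vectors of \<open>\<tau>\<close> keeps independence.
  Applied with \<open>v0\<close> for \<open>x\<close>, where multiplication by the form
  \<open>y\<close> then leaves the localized sum unchanged.\<close>

lemma normalized_normal_vector:
  assumes "\<tau> \<in> \<Delta>" "x \<notin> span (v ` \<tau>)"
  obtains y where "y \<bullet> x = 1" "\<And>i. i \<in> \<tau> \<Longrightarrow> y \<bullet> v i = 0"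
proof -
  have "independent (insert x (v ` \<tau>))"
    using assms(2) cone_independent[OF assms(1)] by (rule independent_insertI)
  from exists_dual_vector[OF this, of "\<lambda>b. if b = x then 1 else 0"]
  obtain y where y: "\<forall>b\<in>insert x (v ` \<tau>). y \<bullet> b = (if b = x then 1 else 0)" ..
  have "v i \<noteq> x" if "i \<in> \<tau>" for i
    using assms(2) that span_base[of "v i" "v ` \<tau>"] by auto
  with y show thesis by (intro that[of y]) auto
qed

text \<open>
  If \<open>\<partial>\<^sub>i\<close> occurs at least twice in a monomial, the linear relation dual to \<open>i\<close> on the
  support trades one copy of it for variables outside the support.
\<close>

lemma degree_d_determined:
  fixes R :: "('n \<Rightarrow>\<^sub>0 nat) \<Rightarrow> real"
  assumes nonface: "\<And>a. deg a = CARD('d) \<Longrightarrow> Poly_Mapping.keys a \<notin> \<Delta> \<Longrightarrow> R a = 0"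
    and rel: "\<And>b y. deg b = CARD('d) - 1 \<Longrightarrow> (\<Sum>s\<in>UNIV. (y \<bullet> v s) * R (b + var s)) = 0"
    and cone: "\<And>a. deg a = CARD('d) \<Longrightarrow> card (Poly_Mapping.keys a) = CARD('d) \<Longrightarrow>
      Poly_Mapping.keys a \<in> \<Delta> \<Longrightarrow> R a = 0"
    and "deg a = CARD('d)"
  shows "R a = 0"
  using \<open>deg a = CARD('d)\<close>
proof (induction "CARD('d) - card (Poly_Mapping.keys a)" arbitrary: a rule: less_induct)
  case less
  show ?case
  proof (cases "Poly_Mapping.keys a \<in> \<Delta> \<and> card (Poly_Mapping.keys a) \<noteq> CARD('d)")
    case False
    then show ?thesis using nonface cone less.prems by blast
  next
    case True
    then have lt: "card (Poly_Mapping.keys a) < CARD('d)"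
      using card_keys_le_deg[of a] less.prems by linarith
    then have "card (Poly_Mapping.keys a) < deg a" using less.prems by simp
    then obtain i b where b: "a = b + var i" "i \<in> Poly_Mapping.keys b"
      by (rule repeated_variable)
    have keys: "Poly_Mapping.keys a = Poly_Mapping.keys b"
      using b keys_add_var[of b i] by (simp add: insert_absorb)
    have degb: "deg b = CARD('d) - 1"
      using less.prems by (simp add: b deg_add)
    obtain y where y: "\<forall>j\<in>Poly_Mapping.keys b. y \<bullet> v j = (if j = i then 1 else 0)"
      using dual_vector_on_cone[of "Poly_Mapping.keys b" "\<lambda>j. if j = i then 1 else 0"] True keys by auto
    \<comment> \<open>On the support only \<open>i\<close> has a nonzero coefficient; a variable
      outside enlarges the support, where the induction hypothesis gives 0.\<close>
    have "(y \<bullet> v s) * R (b + var s) = (if s = i then R a else 0)" for s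
    proof (cases "s \<in> Poly_Mapping.keys b")
      case True
      then show ?thesis using y by (simp add: b)
    next
      case False
      have "R (b + var s) = 0"
        using False lt keys degb by (intro less.hyps) (auto simp: keys_add_var deg_add)
      then show ?thesis using False b(2) by auto
    qed
    then have "(\<Sum>s\<in>UNIV. (y \<bullet> v s) * R (b + var s)) = R a"
      by simp
    then show ?thesis using rel[OF degb, of y] by simp
  qed
qed

end

text \<open>The last two assumptions make \<open>c \<sigma>\<close> the coordinates of
  \<open>v0\<close> on each maximal cone; determinants enter only when \<open>X\<close> is compared
  with them.\<close>

locale weighted_fan = fan \<Delta> v for \<Delta> and v :: "'n::finite \<Rightarrow> real ^ 'd" +
  fixes w :: "'n set \<Rightarrow> real" and v0 :: "real ^ 'd" and c :: "'n set \<Rightarrow> 'n \<Rightarrow> real"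
  assumes weight: "w \<in> MW \<Delta> v" and general: "general_vector \<Delta> v v0"
    and coord_outside: "\<sigma> \<in> cones \<Delta> CARD('d) \<Longrightarrow> i \<notin> \<sigma> \<Longrightarrow> c \<sigma> i = 0"
    and coord_sum: "\<sigma> \<in> cones \<Delta> CARD('d) \<Longrightarrow> (\<Sum>i\<in>\<sigma>. c \<sigma> i *\<^sub>R v i) = v0"
begin

text \<open>Otherwise \<open>v0\<close> would lie in the span of the facet
  \<open>\<sigma> - {i}\<close>, which generality forbids.\<close>

lemma coord_nonzero:
  assumes \<sigma>: "\<sigma> \<in> cones \<Delta> CARD('d)" and i: "i \<in> \<sigma>"
  shows "c \<sigma> i \<noteq> 0"
proof
  assume "c \<sigma> i = 0"
  then have "v0 = (\<Sum>j\<in>\<sigma> - {i}. c \<sigma> j *\<^sub>R v j)"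
    using coord_sum[OF \<sigma>] i by (simp add: sum.remove)
  also have "\<dots> \<in> span (v ` (\<sigma> - {i}))"
    by (intro span_sum span_scale span_base) auto
  finally have "v0 \<in> span (v ` (\<sigma> - {i}))" .
  moreover have "\<sigma> - {i} \<in> cones \<Delta> (CARD('d) - 1)"
    using \<sigma> i face_closed[of \<sigma> "\<sigma> - {i}"] by (auto simp: cones_def)
  ultimately show False using general by (auto simp: general_vector_def)
qed

text \<open>Pairing \<open>coord_sum\<close> with \<open>y\<close> gives the linear form of
  \<open>y\<close> the same value at the coordinate point of every maximal cone.\<close>

lemma inner_coord_sum:
  assumes \<sigma>: "\<sigma> \<in> cones \<Delta> CARD('d)"
  shows "(\<Sum>s\<in>UNIV. (y \<bullet> v s) * c \<sigma> s) = y \<bullet> v0"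
proof -
  have "(\<Sum>s\<in>UNIV. (y \<bullet> v s) * c \<sigma> s) = (\<Sum>s\<in>\<sigma>. (y \<bullet> v s) * c \<sigma> s)"
    using coord_outside[OF \<sigma>] by (intro sum.mono_neutral_right) auto
  also have "\<dots> = y \<bullet> (\<Sum>s\<in>\<sigma>. c \<sigma> s *\<^sub>R v s)"
    by (simp add: inner_sum_right mult.commute)
  finally show ?thesis by (simp add: coord_sum[OF \<sigma>])
qed

text \<open>Defined in every degree, since its vanishing below degree d is what makes the degree d
  values respect the linear relations.\<close>

definition localized :: "('n \<Rightarrow>\<^sub>0 nat) \<Rightarrow> real" where
  "localized a = (\<Sum>\<sigma>\<in>cones \<Delta> CARD('d). w \<sigma> * (eval_mon (c \<sigma>) a / (\<Prod>i\<in>\<sigma>. c \<sigma> i)))"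

text \<open>Every summand acquires the factor of \<open>inner_coord_sum\<close>, which does not
  depend on the cone and can be pulled out.\<close>

lemma localized_relation:
  "(\<Sum>s\<in>UNIV. (y \<bullet> v s) * localized (a + var s)) = (y \<bullet> v0) * localized a"
proof -
  have "(\<Sum>s\<in>UNIV. (y \<bullet> v s) * localized (a + var s)) =
      (\<Sum>\<sigma>\<in>cones \<Delta> CARD('d). \<Sum>s\<in>UNIV.
        ((y \<bullet> v s) * c \<sigma> s) * (w \<sigma> * (eval_mon (c \<sigma>) a / (\<Prod>i\<in>\<sigma>. c \<sigma> i))))"
    unfolding localized_def sum_distrib_left
    by (subst sum.swap) (simp add: eval_mon_add ac_simps)
  also have "\<dots> = (\<Sum>\<sigma>\<in>cones \<Delta> CARD('d).
        (y \<bullet> v0) * (w \<sigma> * (eval_mon (c \<sigma>) a / (\<Prod>i\<in>\<sigma>. c \<sigma> i))))"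
    by (intro sum.cong refl) (simp only: inner_coord_sum flip: sum_distrib_right)
  finally show ?thesis
    by (simp add: localized_def sum_distrib_left)
qed

lemma eval_mon_coord_eq_0:
  assumes "\<sigma> \<in> cones \<Delta> CARD('d)" "\<not> Poly_Mapping.keys a \<subseteq> \<sigma>"
  shows "eval_mon (c \<sigma>) a = 0"
  using assms coord_outside eval_mon_eq_0 by blast

lemma localized_non_face:
  assumes "Poly_Mapping.keys a \<notin> \<Delta>"
  shows "localized a = 0"
proof -
  have "eval_mon (c \<sigma>) a = 0" if "\<sigma> \<in> cones \<Delta> CARD('d)" for \<sigma>
  proof (rule eval_mon_coord_eq_0[OF that])
    show "\<not> Poly_Mapping.keys a \<subseteq> \<sigma>"
      using assms face_closed that by (auto simp: cones_def)
  qed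
  then show ?thesis by (simp add: localized_def)
qed

text \<open>Maximal cones have equal size, so none but the support itself contains the support;
  there numerator and denominator agree and are nonzero.\<close>

lemma localized_cone:
  assumes a: "deg a = CARD('d)" "card (Poly_Mapping.keys a) = CARD('d)" "Poly_Mapping.keys a \<in> \<Delta>"
  shows "localized a = w (Poly_Mapping.keys a)"
proof -
  let ?\<tau> = "Poly_Mapping.keys a"
  have \<tau>: "?\<tau> \<in> cones \<Delta> CARD('d)" using a by (simp add: cones_def)
  have "w \<sigma> * (eval_mon (c \<sigma>) a / (\<Prod>i\<in>\<sigma>. c \<sigma> i)) = (if \<sigma> = ?\<tau> then w ?\<tau> else 0)"
    if \<sigma>: "\<sigma> \<in> cones \<Delta> CARD('d)" for \<sigma>
  proof (cases "\<sigma> = ?\<tau>")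
    case True
    moreover have "(\<Prod>i\<in>?\<tau>. c ?\<tau> i) \<noteq> 0"
      using coord_nonzero[OF \<tau>] by simp
    ultimately show ?thesis using a by (simp add: eval_mon_square_free)
  next
    case False
    then have "\<not> ?\<tau> \<subseteq> \<sigma>"
      using \<sigma> a(2) card_subset_eq[of \<sigma> ?\<tau>] by (auto simp: cones_def)
    then show ?thesis using False by (simp add: eval_mon_coord_eq_0[OF \<sigma>])
  qed
  then show ?thesis by (simp add: localized_def \<tau> cong: sum.cong)
qed

text \<open>Each maximal cone around the facet contributes its weight over the coordinate of its
  extra ray; balancing is then tested against a form vanishing on the facet.\<close>

lemma localized_facet:
  assumes a: "card (Poly_Mapping.keys a) = CARD('d) - 1" "deg a = CARD('d) - 1"
    and face: "Poly_Mapping.keys a \<in> \<Delta>"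
  shows "localized a = 0"
proof -
  let ?\<tau> = "Poly_Mapping.keys a"
  let ?S = "{\<sigma> \<in> cones \<Delta> CARD('d). ?\<tau> \<subseteq> \<sigma>}"
  have \<tau>: "?\<tau> \<in> cones \<Delta> (CARD('d) - 1)" using a face by (simp add: cones_def)
  then have "v0 \<notin> span (v ` ?\<tau>)" using general by (auto simp: general_vector_def)
  then obtain y where y0: "y \<bullet> v0 = 1" and y\<tau>: "\<And>i. i \<in> ?\<tau> \<Longrightarrow> y \<bullet> v i = 0"
    using normalized_normal_vector[OF face] by blast
  have loc: "eval_mon (c \<sigma>) a / (\<Prod>i\<in>\<sigma>. c \<sigma> i) = y \<bullet> v (the_elem (\<sigma> - ?\<tau>))"
    if "\<sigma> \<in> ?S" for \<sigma>
  proof -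
    have \<sigma>: "\<sigma> \<in> cones \<Delta> CARD('d)" "?\<tau> \<subseteq> \<sigma>" using that by auto
    then have "card (\<sigma> - ?\<tau>) = 1"
      using a by (simp add: card_Diff_subset cones_def Suc_diff_le)
    then obtain u where u: "\<sigma> - ?\<tau> = {u}" by (auto simp: card_1_singleton_iff)
    then have ins: "\<sigma> = insert u ?\<tau>" "u \<notin> ?\<tau>" using \<sigma>(2) by auto
    \<comment> \<open>Only the extra ray \<open>u\<close> survives under \<open>y\<close>, so its
      coordinate and \<open>y \<bullet> v u\<close> are inverse to each other.\<close>
    have "y \<bullet> v0 = (\<Sum>s\<in>\<sigma>. c \<sigma> s * (y \<bullet> v s))"
      unfolding coord_sum[OF \<sigma>(1), symmetric] by (simp add: inner_sum_right)
    also have "\<dots> = c \<sigma> u * (y \<bullet> v u)"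
      using y\<tau> by (subst ins(1)) (simp add: ins(2))
    finally have "c \<sigma> u * (y \<bullet> v u) = 1" using y0 by simp
    moreover have "(\<Prod>i\<in>?\<tau>. c \<sigma> i) \<noteq> 0"
      using coord_nonzero[OF \<sigma>(1)] \<sigma>(2) by auto
    moreover have "(\<Prod>i\<in>\<sigma>. c \<sigma> i) = c \<sigma> u * (\<Prod>i\<in>?\<tau>. c \<sigma> i)"
      using prod.insert[OF finite_keys ins(2), of "c \<sigma>"] ins(1) by simp
    ultimately show ?thesis
      using coord_nonzero[OF \<sigma>(1), of u] ins a u by (simp add: eval_mon_square_free field_simps)
  qed
  have "localized a = (\<Sum>\<sigma>\<in>?S. w \<sigma> * (eval_mon (c \<sigma>) a / (\<Prod>i\<in>\<sigma>. c \<sigma> i)))"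
    unfolding localized_def
    by (rule sum.mono_neutral_right) (auto simp: eval_mon_coord_eq_0)
  also have "\<dots> = (\<Sum>\<sigma>\<in>?S. w \<sigma> * (y \<bullet> v (the_elem (\<sigma> - ?\<tau>))))"
    by (rule sum.cong) (simp_all only: loc)
  also have "\<dots> = y \<bullet> (\<Sum>\<sigma>\<in>?S. w \<sigma> *\<^sub>R v (the_elem (\<sigma> - ?\<tau>)))"
    by (simp add: inner_sum_right)
  also have "\<dots> = 0"
  proof -
    have "(\<Sum>\<sigma>\<in>?S. w \<sigma> *\<^sub>R v (the_elem (\<sigma> - ?\<tau>))) \<in> span (v ` ?\<tau>)"
      using weight \<tau> by (auto simp: MW_def)
    then show ?thesis
      by (induction rule: span_induct) (auto simp: y\<tau> inner_add_right intro!: subspaceI)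
  qed
  finally show ?thesis .
qed

text \<open>
  Induction on decreasing support size, then on the degree.  Below degree \<open>d - 1\<close> a linear form that
  is 1 at \<open>v0\<close> and vanishes on the support raises the degree; in degree \<open>d - 1\<close> a repeated variable
  is eliminated, at the cost of a term of smaller degree with the same support.
\<close>

lemma localized_low_degree:
  assumes "deg a < CARD('d)"
  shows "localized a = 0"
  using assms
proof (induction a rule: wf_induct_rule[OF wf_measures[of "[\<lambda>a. CARD('d) - card (Poly_Mapping.keys a), deg]"]])
  case (1 a)
  let ?\<tau> = "Poly_Mapping.keys a"
  \<comment> \<open>Supports are bounded by degrees and thus smaller than d, so the truncated
    difference in the measure really decreases.\<close>
  have IH: "localized b = 0" if "deg b < CARD('d)" "card ?\<tau> < card (Poly_Mapping.keys b) \<or>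
      card (Poly_Mapping.keys b) = card ?\<tau> \<and> deg b < deg a" for b
    using "1.prems" that card_keys_le_deg[of b] card_keys_le_deg[of a] by (intro "1.IH") auto
  consider "?\<tau> \<notin> \<Delta>" | "?\<tau> \<in> \<Delta>" "deg a < CARD('d) - 1"
    | "?\<tau> \<in> \<Delta>" "deg a = CARD('d) - 1" "card ?\<tau> < deg a"
    | "?\<tau> \<in> \<Delta>" "deg a = CARD('d) - 1" "card ?\<tau> = deg a"
    using "1.prems" card_keys_le_deg[of a] by linarith
  then show ?case
  proof cases
    case 1
    then show ?thesis by (rule localized_non_face)
  next
    case 2
    obtain \<sigma> where \<sigma>: "\<sigma> \<in> cones \<Delta> CARD('d)" "?\<tau> \<subseteq> \<sigma>"
      using face_of_maximal[OF 2(1)] by blast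
    \<comment> \<open>Generality speaks of (d-1)-cones only, so the support is first enlarged to
      such a cone inside a maximal one.\<close>
    obtain \<rho> where \<rho>: "?\<tau> \<subseteq> \<rho>" "\<rho> \<subseteq> \<sigma>" "card \<rho> = CARD('d) - 1"
      using exists_subset_between[of ?\<tau> "CARD('d) - 1" \<sigma>] \<sigma> 2(2) card_keys_le_deg[of a]
      by (auto simp: cones_def)
    then have "\<rho> \<in> cones \<Delta> (CARD('d) - 1)"
      using \<sigma> face_closed by (auto simp: cones_def)
    then have "v0 \<notin> span (v ` \<rho>)" using general by (auto simp: general_vector_def)
    then have "v0 \<notin> span (v ` ?\<tau>)" using span_mono[OF image_mono[OF \<rho>(1), of v]] by blast
    then obtain y where y0: "y \<bullet> v0 = 1" and y\<tau>: "\<And>i. i \<in> ?\<tau> \<Longrightarrow> y \<bullet> v i = 0"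
      using normalized_normal_vector[OF 2(1)] by blast
    \<comment> \<open>Either the coefficient vanishes, or the support has grown while the degree
      stays below d.\<close>
    have "(y \<bullet> v s) * localized (a + var s) = 0" for s
    proof (cases "s \<in> ?\<tau>")
      case True
      then show ?thesis by (simp add: y\<tau>)
    next
      case False
      have "localized (a + var s) = 0"
        using 2(2) False by (intro IH) (auto simp: deg_add keys_add_var)
      then show ?thesis by simp
    qed
    then have "(\<Sum>s\<in>UNIV. (y \<bullet> v s) * localized (a + var s)) = 0"
      by (intro sum.neutral) blast
    then show ?thesis
      using localized_relation[of y a] y0 by simp
  next
    case 3
    obtain i b where b: "a = b + var i" "i \<in> Poly_Mapping.keys b"
      by (rule repeated_variable[OF 3(3)])
    have keys: "?\<tau> = Poly_Mapping.keys b"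
      using b keys_add_var[of b i] by (simp add: insert_absorb)
    obtain y where y: "\<forall>j\<in>?\<tau>. y \<bullet> v j = (if j = i then 1 else 0)"
      using dual_vector_on_cone[OF 3(1), of "\<lambda>j. if j = i then 1 else 0"] ..
    \<comment> \<open>\<open>b\<close> has the support of \<open>a\<close> and a smaller degree;
      this kills the right-hand side of \<open>localized_relation\<close>.\<close>
    have "localized b = 0"
      using "1.prems" keys by (intro IH) (auto simp: b deg_add)
    moreover have "(y \<bullet> v s) * localized (b + var s) = (if s = i then localized a else 0)" for s
    proof (cases "s \<in> ?\<tau>")
      case True
      then show ?thesis using y by (simp add: b)
    next
      case False
      have "localized (b + var s) = 0"
        using "1.prems" False keys by (intro IH) (auto simp: b deg_add keys_add_var)
      then show ?thesis using False b(2) keys by auto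
    qed
    ultimately show ?thesis using localized_relation[of y b] by simp
  next
    case 4
    then show ?thesis by (intro localized_facet) simp_all
  qed
qed

end

section \<open>Determinants of column lists\<close>

text \<open>The position map is strictly increasing with values below d, and an injection between
  sets of size d is onto.\<close>

lemma bij_betw_column_position:
  "bij_betw (\<lambda>j::'d::{finite,linorder}. card {l. l < j}) UNIV {..<CARD('d)}"
proof -
  let ?p = "\<lambda>j::'d. card {l. l < j}"
  have less: "?p i < ?p j" if "i < j" for i j
    using that by (intro psubset_card_mono) auto
  have inj: "inj ?p"
    by (rule linorder_injI) (use less in force)
  have "?p j < CARD('d)" for j
    by (rule psubset_card_mono) auto
  then have "range ?p \<subseteq> {..<CARD('d)}" by auto
  moreover have "card (range ?p) = CARD('d)"
    by (simp add: card_image inj)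
  ultimately have "range ?p = {..<CARD('d)}"
    by (intro card_subset_eq) auto
  with inj show ?thesis by (simp add: bij_betw_def)
qed

lemma det_cols_swap:
  fixes a b :: "real ^ 'd::{finite,linorder}"
  assumes len: "length ps + 2 + length qs = CARD('d)"
  shows "det_cols (ps @ b # a # qs) = - det_cols (ps @ a # b # qs)"
proof -
  let ?p = "\<lambda>j::'d. card {l. l < j}"
  have inj: "inj ?p" and ran: "range ?p = {..<CARD('d)}"
    using bij_betw_column_position by (auto simp: bij_betw_def)
  have "length ps \<in> range ?p" unfolding ran using len by simp
  then obtain i where i: "?p i = length ps" by auto
  have "Suc (length ps) \<in> range ?p" unfolding ran using len by simp
  then obtain j where j: "?p j = Suc (length ps)" by auto
  have ij: "i \<noteq> j" using i j by auto
  \<comment> \<open>\<open>i\<close> and \<open>j\<close> are the indices at the two adjacent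
    positions, so swapping the entries permutes the columns by a transposition.\<close>
  have "(ps @ b # a # qs) ! ?p l = (ps @ a # b # qs) ! ?p (Transposition.transpose i j l)" for l
  proof -
    consider "l = i" | "l = j" | "l \<noteq> i" "l \<noteq> j" by blast
    then show ?thesis
    proof cases
      case 3
      then have "?p l \<noteq> length ps" "?p l \<noteq> Suc (length ps)"
        using inj i j by (metis injD)+
      then show ?thesis
        using 3 by (auto simp: nth_append nth_Cons' transpose_apply_other)
    qed (use i j in \<open>simp_all add: nth_append\<close>)
  qed
  then have "det_cols (ps @ b # a # qs) =
      det (\<chi> r l. (\<chi> r l. ((ps @ a # b # qs) ! ?p l) $ r) $ r $ (Transposition.transpose i j l))"
    by (simp add: det_cols_def)
  also have "\<dots> = of_int (sign (Transposition.transpose i j)) * det_cols (ps @ a # b # qs)"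
    unfolding det_cols_def by (rule det_permute_columns) (simp add: permutes_swap_id)
  finally show ?thesis using ij by (simp add: sign_swap_id)
qed

text \<open>One adjacent swap per entry of \<open>ps\<close>. This carries \<open>v0\<close> from
  the front to the place of the removed generator.\<close>

lemma det_cols_cycle:
  fixes a :: "real ^ 'd::{finite,linorder}"
  assumes "length ps + 1 + length qs = CARD('d)"
  shows "det_cols (a # ps @ qs) = (-1) ^ length ps * det_cols (ps @ a # qs)"
  using assms
proof (induction ps arbitrary: qs rule: rev_induct)
  case (snoc x ps)
  then have "det_cols (a # ps @ x # qs) = (-1) ^ length ps * det_cols (ps @ a # x # qs)"
    by simp
  moreover have "det_cols (ps @ x # a # qs) = - det_cols (ps @ a # x # qs)"
    using snoc.prems by (intro det_cols_swap) simp
  ultimately show ?case by simp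
qed simp

text \<open>Cramer's lemma on list positions instead of matrix indices; \<open>?x\<close> transports
  the coefficients along the position bijection.\<close>

lemma det_cols_cramer:
  fixes cs :: "(real ^ 'd::{finite,linorder}) list"
  assumes len: "length cs = CARD('d)" and k: "k < CARD('d)"
  shows "det_cols (cs[k := (\<Sum>m<CARD('d). c m *\<^sub>R cs ! m)]) = c k * det_cols cs"
proof -
  let ?p = "\<lambda>j::'d. card {l. l < j}"
  let ?A = "\<chi> r j. (cs ! ?p j) $ r"
  let ?x = "\<chi> j. c (?p j)"
  have inj: "inj ?p" and ran: "range ?p = {..<CARD('d)}"
    using bij_betw_column_position by (auto simp: bij_betw_def)
  have "k \<in> range ?p" unfolding ran using k by simp
  then obtain j0 where j0: "k = ?p j0" by blast
  have "?A *v ?x = (\<Sum>j\<in>UNIV. c (?p j) *\<^sub>R cs ! ?p j)"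
    by (simp add: vec_eq_iff matrix_vector_mult_def mult.commute)
  also have "\<dots> = (\<Sum>m<CARD('d). c m *\<^sub>R cs ! m)"
    by (rule sum.reindex_bij_betw[OF bij_betw_column_position])
  finally have Ax: "?A *v ?x = (\<Sum>m<CARD('d). c m *\<^sub>R cs ! m)" .
  have "?p j < length cs" for j using ran len by auto
  then have "(\<chi> r j. (cs[k := ?A *v ?x] ! ?p j) $ r) = (\<chi> r j. if j = j0 then (?A *v ?x) $ r else ?A $ r $ j)"
    using inj by (auto simp: vec_eq_iff nth_list_update j0 dest: injD)
  then have "det_cols (cs[k := ?A *v ?x]) = ?x $ j0 * det ?A"
    by (simp only: det_cols_def cramer_lemma)
  then show ?thesis
    unfolding Ax by (simp add: j0 det_cols_def)
qed

text \<open>A nonzero kernel vector would be a linear relation among the entries of the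
  list.\<close>

lemma det_cols_nonzero:
  fixes cs :: "(real ^ 'd::{finite,linorder}) list"
  assumes len: "length cs = CARD('d)" and "distinct cs" and ind: "independent (set cs)"
  shows "det_cols cs \<noteq> 0"
proof
  let ?p = "\<lambda>j::'d. card {l. l < j}"
  let ?g = "\<lambda>j. cs ! ?p j"
  let ?A = "\<chi> r j. ?g j $ r"
  assume "det_cols cs = 0"
  then have "\<not> invertible ?A"
    by (simp add: invertible_det_nz det_cols_def)
  then obtain x where x: "x \<noteq> 0" "?A *v x = 0"
    unfolding invertible_left_inverse matrix_left_invertible_ker by auto
  have "bij_betw ((!) cs \<circ> ?p) UNIV (set cs)"
    by (rule bij_betw_trans[OF bij_betw_column_position]) (simp add: bij_betw_nth assms(2) len)
  then have bij: "bij_betw ?g UNIV (set cs)"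
    by (simp add: comp_def)
  have inj: "inj ?g" using bij by (simp add: bij_betw_def)
  have "?A *v x = (\<Sum>j\<in>UNIV. x $ j *\<^sub>R ?g j)"
    by (simp add: vec_eq_iff matrix_vector_mult_def mult.commute)
  \<comment> \<open>Distinctness lets the coefficients be indexed by vectors instead of columns, the
    form in which independence applies.\<close>
  also have "\<dots> = (\<Sum>j\<in>UNIV. x $ (inv_into UNIV ?g (?g j)) *\<^sub>R ?g j)"
    by (simp add: inv_f_f[OF inj])
  also have "\<dots> = (\<Sum>y\<in>set cs. x $ (inv_into UNIV ?g y) *\<^sub>R y)"
    by (rule sum.reindex_bij_betw[OF bij])
  finally have sum0: "(\<Sum>y\<in>set cs. x $ (inv_into UNIV ?g y) *\<^sub>R y) = 0" using x(2) by simp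
  have "x $ j = 0" for j
  proof -
    have "?g j \<in> set cs" using bij by (auto simp: bij_betw_def)
    then have "x $ (inv_into UNIV ?g (?g j)) = 0"
      by (rule independentD[OF ind finite_set order_refl sum0])
    then show ?thesis by (simp add: inv_f_f[OF inj])
  qed
  with x(1) show False by (simp add: vec_eq_iff)
qed

text \<open>The sign at the one-based position \<open>k + 1\<close> and the sign from moving
  \<open>v0\<close> past \<open>k\<close> columns multiply to -1 for every \<open>k\<close>, so one
  factor serves all generators.\<close>

lemma X_eq_coordinate:
  fixes v :: "'n \<Rightarrow> real ^ 'd::{finite,linorder}"
  assumes gs: "distinct gs" "length gs = CARD('d)"
    and v0: "(\<Sum>i\<in>set gs. c i *\<^sub>R v i) = v0" and i: "i \<in> set gs"
  shows "X v v0 gs i = - det_cols (map v gs) * c i"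
proof -
  obtain k where k: "k < CARD('d)" "i = gs ! k"
    using i gs(2) by (metis in_set_conv_nth)
  let ?vs = "map v gs"
  have "(THE m. 1 \<le> m \<and> m \<le> length gs \<and> gs ! (m - 1) = i) = Suc k"
  proof (rule the_equality)
    show "1 \<le> Suc k \<and> Suc k \<le> length gs \<and> gs ! (Suc k - 1) = i"
      using k gs by simp
    fix m assume "1 \<le> m \<and> m \<le> length gs \<and> gs ! (m - 1) = i"
    then have "m - 1 = k" "1 \<le> m"
      using k gs by (auto simp: nth_eq_iff_index_eq)
    then show "m = Suc k" by simp
  qed
  then have "X v v0 gs i = (-1) ^ Suc k * det_cols (v0 # take k ?vs @ drop (Suc k) ?vs)"
    using i by (simp add: X_def X_entry_def remove_col_def)
  also have "det_cols (v0 # take k ?vs @ drop (Suc k) ?vs) =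
      (-1) ^ k * det_cols (take k ?vs @ v0 # drop (Suc k) ?vs)"
    using det_cols_cycle[of "take k ?vs" "drop (Suc k) ?vs" v0] k gs(2) by (simp add: min_def)
  also have "take k ?vs @ v0 # drop (Suc k) ?vs = ?vs[k := v0]"
    using k gs(2) by (simp add: upd_conv_take_nth_drop)
  also have "det_cols (?vs[k := v0]) = c (gs ! k) * det_cols ?vs"
  proof -
    have "v0 = (\<Sum>m<length gs. c (gs ! m) *\<^sub>R v (gs ! m))"
      unfolding v0[symmetric]
      by (rule sum.reindex_bij_betw[OF bij_betw_nth[OF gs(1)], symmetric]) simp_all
    then have "v0 = (\<Sum>m<CARD('d). c (gs ! m) *\<^sub>R ?vs ! m)"
      by (simp add: gs(2))
    then show ?thesis
      using k gs(2) det_cols_cramer[of ?vs k "\<lambda>m. c (gs ! m)"] by simp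
  qed
  finally show ?thesis
    by (simp add: k(2) flip: power_add mult.assoc)
qed

section \<open>The volume form\<close>

text \<open>Expanding \<open>y \<bullet> v s\<close> in coordinates and exchanging sums derives the
  relations for all \<open>y\<close> from the forms \<open>theta v k\<close>.\<close>

lemma linear_form_eq_theta:
  "(\<Sum>s\<in>UNIV. const (y \<bullet> v s) * del s) = (\<Sum>k\<in>UNIV. const (y $ k) * theta v k)"
  unfolding theta_def sum_distrib_left
  by (subst sum.swap)
    (simp add: inner_vec_def const_sum sum_distrib_right const_mult flip: mult.assoc)

lemma CH_class_theta_sum:
  assumes "finite A"
  shows "CH_class \<Delta> v (\<Sum>k\<in>A. h k * theta v k) = CH_class \<Delta> v 0"
  using assms
proof (induction A rule: finite_induct)
  case (insert k A)
  then have "CH_class \<Delta> v (\<Sum>k\<in>insert k A. h k * theta v k) =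
      CH_class \<Delta> v 0 \<oplus>\<^bsub>CH \<Delta> v\<^esub> CH_class \<Delta> v 0"
    by (simp add: CH_class_theta flip: CH_class_add)
  then show ?case by (simp add: CH_class_add)
qed simp

lemma CH_class_linear_form:
  "CH_class \<Delta> v (\<Sum>s\<in>UNIV. const (y \<bullet> v s) * monomial (b + var s)) = CH_class \<Delta> v 0"
proof -
  have "(\<Sum>s\<in>UNIV. const (y \<bullet> v s) * monomial (b + var s)) =
      (\<Sum>k\<in>UNIV. (monomial b * const (y $ k)) * theta v k)"
    unfolding monomial_mult_linear_form[symmetric] linear_form_eq_theta
    by (simp add: sum_distrib_left mult.assoc)
  then show ?thesis by (simp add: CH_class_theta_sum)
qed

section \<open>The volume on polynomials, existence and uniqueness of \<open>phi\<close>\<close>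

context weighted_fan
begin

text \<open>Cut off outside degree d: ideal elements and representatives of classes may be
  inhomogeneous, and above degree d \<open>localized\<close> need not respect the linear
  relations.\<close>

definition vol_form :: "'n mpoly \<Rightarrow> real" where
  "vol_form = lin_ext (\<lambda>a. if deg a = CARD('d) then localized a else 0)"

lemma vol_form_non_face:
  assumes "S \<notin> \<Delta>"
  shows "vol_form (h * del_cone S) = 0"
  unfolding vol_form_def
proof (rule lin_ext_mult_eq_0)
  fix a :: "'n \<Rightarrow>\<^sub>0 nat"
  let ?b = "a + (\<Sum>i\<in>S. var i)"
  have "monomial a * del_cone S = monomial ?b"
    by (simp add: monomial_mult flip: monomial_square_free)
  moreover have "S \<subseteq> Poly_Mapping.keys ?b"
    by (auto simp: in_keys_iff lookup_add lookup_sum lookup_single when_def)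
  then have "localized ?b = 0"
    using assms face_closed by (intro localized_non_face) blast
  ultimately show "lin_ext (\<lambda>a. if deg a = CARD('d) then localized a else 0)
      (monomial a * del_cone S) = 0"
    by simp
qed

text \<open>A monomial multiple of \<open>theta v k\<close> reaches degree d only from degree d-1.
  There \<open>localized_relation\<close> for the \<open>k\<close>-th unit vector leaves a multiple
  of a localized sum that is 0.\<close>

lemma vol_form_theta: "vol_form (h * theta v k) = 0"
  unfolding vol_form_def
proof (rule lin_ext_mult_eq_0)
  fix a :: "'n \<Rightarrow>\<^sub>0 nat"
  let ?T = "\<lambda>a. if deg a = CARD('d) then localized a else 0"
  have "lin_ext ?T (monomial a * theta v k) = (\<Sum>s\<in>UNIV. (axis k 1 \<bullet> v s) * ?T (a + var s))"
    unfolding theta_def monomial_mult_linear_form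
    by (simp add: lin_ext_sum lin_ext_const_mult inner_axis')
  also have "\<dots> = (if deg a + 1 = CARD('d) then (\<Sum>s\<in>UNIV. (axis k 1 \<bullet> v s) * localized (a + var s)) else 0)"
    by (simp add: deg_add)
  also have "\<dots> = 0"
    by (simp add: localized_relation localized_low_degree)
  finally show "lin_ext ?T (monomial a * theta v k) = 0" .
qed

lemma vol_form_CH_class:
  assumes "CH_class \<Delta> v f = CH_class \<Delta> v g"
  shows "vol_form f = vol_form g"
proof -
  \<comment> \<open>Requiring all multiples to have volume 0 makes this set an ideal; the multiplier
    1 then recovers the polynomial itself.\<close>
  have "f - g \<in> {f. \<forall>h. vol_form (h * f) = 0}"
  proof (rule CH_class_eq_imp[OF _ _ _ _ _ assms])
    show "h * f \<in> {f. \<forall>h. vol_form (h * f) = 0}"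
      if "f \<in> {f. \<forall>h. vol_form (h * f) = 0}" for f h
      using that by (simp flip: mult.assoc)
  qed (simp_all add: vol_form_theta vol_form_non_face non_face distrib_left,
      simp_all add: vol_form_def lin_ext_add)
  then have "vol_form (1 * (f - g)) = 0" by blast
  then have "vol_form (f + - g) = 0" by simp
  then show ?thesis
    unfolding vol_form_def by (simp only: lin_ext_add lin_ext_uminus)
qed

lemma vol_form_homogeneous:
  assumes "homogeneous CARD('d) f"
  shows "vol_form f =
    (\<Sum>\<sigma>\<in>cones \<Delta> CARD('d). w \<sigma> * (eval_mpoly f (c \<sigma>) / (\<Prod>i\<in>\<sigma>. c \<sigma> i)))"
proof -
  have "vol_form f = (\<Sum>a\<in>Poly_Mapping.keys f. Poly_Mapping.lookup f a * localized a)"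
    using assms unfolding vol_form_def lin_ext_def
    by (intro sum.cong) (auto simp: homogeneous_iff)
  also have "\<dots> = (\<Sum>\<sigma>\<in>cones \<Delta> CARD('d). \<Sum>a\<in>Poly_Mapping.keys f.
      Poly_Mapping.lookup f a * (w \<sigma> * (eval_mon (c \<sigma>) a / (\<Prod>i\<in>\<sigma>. c \<sigma> i))))"
    unfolding localized_def sum_distrib_left by (rule sum.swap)
  finally show ?thesis
    by (simp add: eval_mpoly_eq_lin_ext lin_ext_def sum_distrib_left sum_divide_distrib ac_simps)
qed

text \<open>On monomials the difference of the two functionals satisfies the hypotheses of
  \<open>degree_d_determined\<close>: both respect non-faces and linear relations and agree on
  maximal cones.\<close>

lemma CH_linear_eq_vol_form:
  assumes lin: "CH_linear \<Delta> v CARD('d) \<phi>"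
    and val: "\<And>\<sigma>. \<sigma> \<in> cones \<Delta> CARD('d) \<Longrightarrow> \<phi> (CH_class \<Delta> v (del_cone \<sigma>)) = w \<sigma>"
    and hom: "homogeneous CARD('d) f"
  shows "\<phi> (CH_class \<Delta> v f) = vol_form f"
proof -
  let ?l = "\<lambda>f. \<phi> (CH_class \<Delta> v f)"
  have add: "?l (f + g) = ?l f + ?l g"
    if "homogeneous CARD('d) f" "homogeneous CARD('d) g" for f g
    using lin that unfolding CH_linear_def CH_graded_def by (simp flip: CH_class_add)
  have scale: "?l (const r * f) = r * ?l f" if "homogeneous CARD('d) f" for r f
    using lin that unfolding CH_linear_def CH_graded_def by (simp flip: CH_class_mult)
  have zero: "?l 0 = 0"
    using scale[of 0 0] by (simp add: homogeneous_iff const_def)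
  \<comment> \<open>Linearity of \<open>\<phi>\<close> is given on classes of degree d only, so
    homogeneity must accompany every partial sum.\<close>
  have sum: "?l (\<Sum>s\<in>A. const (r s) * monomial (m s)) = (\<Sum>s\<in>A. r s * ?l (monomial (m s)))"
    if "finite A" "\<And>s. s \<in> A \<Longrightarrow> deg (m s) = CARD('d)"
    for A :: "'s set" and r :: "'s \<Rightarrow> real" and m :: "'s \<Rightarrow> 'n \<Rightarrow>\<^sub>0 nat"
    using that
  proof (induction A rule: finite_induct)
    case (insert x A)
    have "homogeneous CARD('d) (monomial (m s))" if "s \<in> insert x A" for s
      using insert.prems[OF that] homogeneous_monomial[of "m s"] by simp
    then show ?case
      using insert by (simp add: add scale homogeneous_const_mult homogeneous_sum)
  qed (simp add: zero)
  have monomial: "?l (monomial a) = localized a" if a: "deg a = CARD('d)" for a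
  proof -
    have "?l (monomial a) - localized a = 0"
      using a
    proof (rule degree_d_determined[rotated 3])
      fix a :: "'n \<Rightarrow>\<^sub>0 nat"
      assume "Poly_Mapping.keys a \<notin> \<Delta>"
      moreover obtain b where "monomial a = monomial b * del_cone (Poly_Mapping.keys a)"
        using monomial_dvd_del_cone by blast
      ultimately have "CH_class \<Delta> v (monomial a) = CH_class \<Delta> v 0"
        using CH_class_non_face by (simp add: non_face)
      then show "?l (monomial a) - localized a = 0"
        using \<open>Poly_Mapping.keys a \<notin> \<Delta>\<close> by (simp add: zero localized_non_face)
    next
      fix b :: "'n \<Rightarrow>\<^sub>0 nat" and y :: "real ^ 'd"
      assume b: "deg b = CARD('d) - 1"
      have "(\<Sum>s\<in>UNIV. (y \<bullet> v s) * ?l (monomial (b + var s))) =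
          ?l (\<Sum>s\<in>UNIV. const (y \<bullet> v s) * monomial (b + var s))"
        by (rule sum[symmetric]) (simp_all add: deg_add b)
      also have "\<dots> = 0" by (simp only: CH_class_linear_form zero)
      finally show "(\<Sum>s\<in>UNIV. (y \<bullet> v s) * (?l (monomial (b + var s)) - localized (b + var s))) = 0"
        by (simp add: right_diff_distrib sum_subtractf localized_relation localized_low_degree b)
    next
      fix a :: "'n \<Rightarrow>\<^sub>0 nat"
      assume a: "deg a = CARD('d)" "card (Poly_Mapping.keys a) = CARD('d)" "Poly_Mapping.keys a \<in> \<Delta>"
      then show "?l (monomial a) - localized a = 0"
        using val[of "Poly_Mapping.keys a"]
        by (simp add: monomial_eq_del_cone localized_cone cones_def)
    qed
    then show ?thesis by simp
  qed
  have deg: "deg a = CARD('d)" if "a \<in> Poly_Mapping.keys f" for a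
    using hom that by (simp add: homogeneous_iff)
  have "?l f = ?l (\<Sum>a\<in>Poly_Mapping.keys f. const (Poly_Mapping.lookup f a) * monomial a)"
    by (simp flip: mpoly_eq_sum_monomials)
  also have "\<dots> = (\<Sum>a\<in>Poly_Mapping.keys f. Poly_Mapping.lookup f a * ?l (monomial a))"
    by (rule sum) (simp_all add: deg)
  also have "\<dots> = vol_form f"
    unfolding vol_form_def lin_ext_def by (rule sum.cong) (simp_all add: monomial deg)
  finally show ?thesis .
qed

text \<open>\<open>phi\<close> is a definite description, so a functional with its properties is
  constructed and shown to be the only one.\<close>

lemma Vol_eq_vol_form:
  assumes "homogeneous CARD('d) f"
  shows "Vol \<Delta> v w f = vol_form f"
proof -
  let ?G = "CH_graded \<Delta> v CARD('d)"
  \<comment> \<open>The chosen representative may be inhomogeneous; \<open>vol_form_CH_class\<close>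
    makes the value independent of it.\<close>
  define \<phi> where "\<phi> = restrict (\<lambda>x. vol_form (SOME f. CH_class \<Delta> v f = x)) ?G"
  have \<phi>: "\<phi> (CH_class \<Delta> v f) = vol_form f" if "homogeneous CARD('d) f" for f
  proof -
    have "CH_class \<Delta> v (SOME g. CH_class \<Delta> v g = CH_class \<Delta> v f) = CH_class \<Delta> v f"
      by (rule someI) (rule refl)
    then have "vol_form (SOME g. CH_class \<Delta> v g = CH_class \<Delta> v f) = vol_form f"
      by (rule vol_form_CH_class)
    then show ?thesis
      using that unfolding \<phi>_def by (simp add: CH_graded_def)
  qed
  have "phi \<Delta> v w = \<phi>"
    unfolding phi_def
  proof (rule the_equality)
    have "CH_linear \<Delta> v CARD('d) \<phi>"
      unfolding CH_linear_def CH_graded_def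
      by (auto simp: CH_class_add CH_class_mult \<phi> homogeneous_add homogeneous_const_mult)
        (simp_all add: vol_form_def lin_ext_add lin_ext_const_mult)
    moreover have "\<phi> (CH_class \<Delta> v (del_cone \<sigma>)) = w \<sigma>" if \<sigma>: "\<sigma> \<in> cones \<Delta> CARD('d)" for \<sigma>
    proof -
      let ?a = "\<Sum>i\<in>\<sigma>. var i"
      have lookup: "Poly_Mapping.lookup ?a i = (if i \<in> \<sigma> then 1 else 0)" for i
        by (simp add: lookup_sum lookup_single when_def)
      then have keys: "Poly_Mapping.keys ?a = \<sigma>"
        by (auto simp: in_keys_iff split: if_splits)
      have deg: "deg ?a = CARD('d)"
        using \<sigma> by (simp add: deg_eq_sum_keys keys lookup cones_def)
      have "del_cone \<sigma> = monomial ?a"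
        by (simp add: monomial_square_free)
      then show ?thesis
        using homogeneous_monomial[of ?a] localized_cone[of ?a] \<sigma> deg keys
        by (simp add: \<phi> vol_form_def cones_def)
    qed
    ultimately show "\<phi> \<in> extensional ?G \<and> CH_linear \<Delta> v CARD('d) \<phi> \<and>
        (\<forall>\<sigma>\<in>cones \<Delta> CARD('d). \<phi> (CH_class \<Delta> v (del_cone \<sigma>)) = w \<sigma>)"
      by (simp add: \<phi>_def)
  next
    fix \<psi>
    assume \<psi>: "\<psi> \<in> extensional ?G \<and> CH_linear \<Delta> v CARD('d) \<psi> \<and>
        (\<forall>\<sigma>\<in>cones \<Delta> CARD('d). \<psi> (CH_class \<Delta> v (del_cone \<sigma>)) = w \<sigma>)"
    show "\<psi> = \<phi>"
    proof (rule extensionalityI[of _ ?G])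
      fix x assume "x \<in> ?G"
      then obtain f where "homogeneous CARD('d) f" "x = CH_class \<Delta> v f"
        by (auto simp: CH_graded_def)
      then show "\<psi> x = \<phi> x"
        using \<psi> CH_linear_eq_vol_form[of \<psi> f] by (simp add: \<phi>)
    qed (use \<psi> in \<open>simp_all add: \<phi>_def\<close>)
  qed
  then show ?thesis by (simp add: Vol_def \<phi> assms)
qed

end

theorem theorem4p2:
  fixes \<Delta> :: "'n::finite set set"
    and v :: "'n \<Rightarrow> real ^ 'd::{finite,linorder}"
    and w :: "'n set \<Rightarrow> real"
    and v0 :: "real ^ 'd::{finite,linorder}"
    and gens :: "'n set \<Rightarrow> 'n list"
    and f :: "'n mpoly"
  assumes "is_fan \<Delta> v"
    and "w \<in> MW \<Delta> v"
    and "general_vector \<Delta> v v0"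
    and "\<And>\<sigma>. \<sigma> \<in> cones \<Delta> CARD('d) \<Longrightarrow> distinct (gens \<sigma>) \<and> set (gens \<sigma>) = \<sigma>"
    and "homogeneous CARD('d) f"
  shows "Vol \<Delta> v w f =
    (\<Sum>\<sigma>\<in>cones \<Delta> CARD('d).
       w \<sigma> * (eval_mpoly f (X v v0 (gens \<sigma>)) / (\<Prod>i\<in>\<sigma>. X v v0 (gens \<sigma>) i)))"
proof -
  \<comment> \<open>\<open>D \<sigma>\<close> is the factor of \<open>X_eq_coordinate\<close>;
    dividing \<open>X\<close> by it leaves the coordinates of \<open>v0\<close>.\<close>
  define D where "D \<sigma> = - det_cols (map v (gens \<sigma>))" for \<sigma>
  define c where "c \<sigma> i = X v v0 (gens \<sigma>) i / D \<sigma>" for \<sigma> i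
  interpret fan \<Delta> v by unfold_locales (rule assms(1))
  have cone: "D \<sigma> \<noteq> 0 \<and> (\<Sum>i\<in>\<sigma>. c \<sigma> i *\<^sub>R v i) = v0" if \<sigma>: "\<sigma> \<in> cones \<Delta> CARD('d)" for \<sigma>
  proof -
    have gens: "distinct (gens \<sigma>)" "set (gens \<sigma>) = \<sigma>" using assms(4)[OF \<sigma>] by auto
    have card: "card \<sigma> = CARD('d)" and face: "\<sigma> \<in> \<Delta>" using \<sigma> by (auto simp: cones_def)
    then have len: "length (gens \<sigma>) = CARD('d)" using gens distinct_card by fastforce
    note inj = cone_inj[OF face] and ind = cone_independent[OF face]
    have nz: "D \<sigma> \<noteq> 0"
      unfolding D_def using det_cols_nonzero[of "map v (gens \<sigma>)"] len gens inj ind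
      by (simp add: distinct_map)
    have "UNIV \<subseteq> span (v ` \<sigma>)"
      by (rule card_ge_dim_independent) (use ind in \<open>simp_all add: card_image[OF inj] card\<close>)
    then have "v0 \<in> span (v ` \<sigma>)" by blast
    then obtain u where "v0 = (\<Sum>b\<in>v ` \<sigma>. u b *\<^sub>R b)"
      by (auto simp: span_finite)
    then have u: "(\<Sum>i\<in>\<sigma>. u (v i) *\<^sub>R v i) = v0"
      by (simp add: sum.reindex[OF inj])
    then have "X v v0 (gens \<sigma>) i = D \<sigma> * u (v i)" if "i \<in> \<sigma>" for i
      unfolding D_def using that gens len by (intro X_eq_coordinate) simp_all
    then have "c \<sigma> i = u (v i)" if "i \<in> \<sigma>" for i
      using that nz by (simp add: c_def)
    with u nz show ?thesis by simp
  qed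
  interpret weighted_fan \<Delta> v w v0 c
  proof unfold_locales
    fix \<sigma> i assume "\<sigma> \<in> cones \<Delta> CARD('d)" "i \<notin> \<sigma>"
    then show "c \<sigma> i = 0" using assms(4)[of \<sigma>] by (simp add: c_def X_def)
  qed (use assms cone in blast)+
  \<comment> \<open>Numerator and denominator both scale by the d-th power of
    \<open>D \<sigma>\<close>.\<close>
  have "eval_mpoly f (c \<sigma>) / (\<Prod>i\<in>\<sigma>. c \<sigma> i) =
      eval_mpoly f (X v v0 (gens \<sigma>)) / (\<Prod>i\<in>\<sigma>. X v v0 (gens \<sigma>) i)"
    if \<sigma>: "\<sigma> \<in> cones \<Delta> CARD('d)" for \<sigma>
  proof -
    have "D \<sigma> \<noteq> 0" using cone[OF \<sigma>] by blast
    then have X: "X v v0 (gens \<sigma>) = (\<lambda>i. D \<sigma> * c \<sigma> i)" by (auto simp: c_def)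
    have "card \<sigma> = CARD('d)" using \<sigma> by (simp add: cones_def)
    then show ?thesis
      using \<open>D \<sigma> \<noteq> 0\<close> unfolding X eval_mpoly_scale[OF assms(5)]
      by (simp add: prod.distrib)
  qed
  then show ?thesis
    by (simp add: Vol_eq_vol_form[OF assms(5)] vol_form_homogeneous[OF assms(5)])
qed

end
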